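(* $$A^{(2)}(x_1,x_2,x_3,\dots)=1+\frac{x_1^2(1-x_2+x_2A^{(2)}(x_1,x_2x_3,x_3x_4,\dots))}{1-x_1^2x_2(1-x_2x_3+x_2x_3A^{(2)}(x_1,x_2x_3^2x_4,x_3x_4^2x_5,\dots))},$$ and $$B^{(2)}(x_1,x_2,x_3,\dots)=x_1-x_1x_2+x_1x_2A^{(2)}(x_1,x_2x_3,x_3x_4\dots).$$
   Context: A permutation $\pi$ is a Dumont permutation (of the first kind) if each even integer in $\pi$ is followed by a smaller integer, and each odd integer is either followed by a larger integer or is the last element of $\pi$. Let $\mathcal{D}$ be the set of Dumont permutations of all sizes (including the empty one) avoiding $1\mbox{-}3\mbox{-}2$. Generalized patterns: letters separated by dashes may be at any distance, adjacent letters (as $12$ in $12\mbox{-}3\mbox{-}\cdots\mbox{-}j$) must be adjacent in $\pi$. For a pattern $\tau$, $\tau(\pi)$ is its number of occurrences in $\pi$; $1(\pi)$ is the length of $\pi$. Define $\mathcal{B}(x_1,x_2,\dots)=\sum_{\pi\in\mathcal{D}}x_1^{1(\pi)}\prod_{j\geq2}x_j^{12\mbox{-}3\mbox{-}\dots\mbox{-} j(\pi)}$, $A^{(2)}(x_1,x_2,\dots)=\frac12(\mathcal{B}(x_1,x_2,\dots)+\mathcal{B}(-x_1,x_2,\dots))$, $B^{(2)}(x_1,x_2,\dots)=\frac12(\mathcal{B}(x_1,x_2,\dots)-\mathcal{B}(-x_1,x_2,\dots))$. *)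

theory Defs
  imports
    "HOL-Combinatorics.Multiset_Permutations"
    "HOL-Computational_Algebra.Formal_Power_Series"
    "HOL-Computational_Algebra.Fraction_Field"
    "HOL-Library.Poly_Mapping"
begin

definition dumont :: "nat list \<Rightarrow> bool" where
  "dumont \<pi> \<longleftrightarrow>
     (\<forall>i < length \<pi>.
        (even (\<pi> ! i) \<longrightarrow> i + 1 < length \<pi> \<and> \<pi> ! (i + 1) < \<pi> ! i) \<and>
        (odd (\<pi> ! i) \<longrightarrow> i + 1 = length \<pi> \<or> \<pi> ! (i + 1) > \<pi> ! i))"

text \<open>
  A generalized pattern is a word \<open>w\<close> together with the set \<open>adj\<close> of (0-based) positions \<open>a\<close>
  such that there is no dash between the letters \<open>w ! a\<close> and \<open>w ! (a + 1)\<close>.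
  An occurrence is identified with the increasing list of positions that it occupies.
\<close>

type_synonym gen_pattern = "nat list \<times> nat set"

definition occurrences :: "gen_pattern \<Rightarrow> nat list \<Rightarrow> nat list set" where
  "occurrences = (\<lambda>(w, adj) \<pi>.
     {ps. length ps = length w \<and> sorted_wrt (<) ps \<and> set ps \<subseteq> {..<length \<pi>} \<and>
          (\<forall>a\<in>adj. ps ! (a + 1) = ps ! a + 1) \<and>
          (\<forall>a < length w. \<forall>b < length w. \<pi> ! (ps ! a) < \<pi> ! (ps ! b) \<longleftrightarrow> w ! a < w ! b)})"

definition occ :: "gen_pattern \<Rightarrow> nat list \<Rightarrow> nat" where
  "occ p \<pi> = card (occurrences p \<pi>)"

definition avoids :: "nat list \<Rightarrow> gen_pattern \<Rightarrow> bool" where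
  "avoids \<pi> p \<longleftrightarrow> occurrences p \<pi> = {}"

text \<open>The pattern 1-3-2, and the pattern 12-3-\<open>\<dots>\<close>-\<open>j\<close> for \<open>j \<ge> 2\<close>.\<close>

definition pat_132 :: gen_pattern where
  "pat_132 = ([1, 3, 2], {})"

definition pat_inc :: "nat \<Rightarrow> gen_pattern" where
  "pat_inc j = ([1..<j + 1], {0})"

lemma occ_eq_0:
  assumes "length (fst p) > length \<pi>"
  shows "occ p \<pi> = 0"
proof -
  have False if "ps \<in> occurrences p \<pi>" for ps
  proof -
    have ps: "length ps = length (fst p)" "sorted_wrt (<) ps" "set ps \<subseteq> {..<length \<pi>}"
      using that by (auto simp: occurrences_def split: prod.splits)
    then have "length ps = card (set ps)"
      by (simp add: distinct_card strict_sorted_iff)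
    also have "\<dots> \<le> length \<pi>"
      using card_mono[OF _ ps(3)] by simp
    finally show False using assms ps(1) by simp
  qed
  then have "occurrences p \<pi> = {}" by blast
  then show ?thesis by (simp add: occ_def)
qed

definition Dumont132 :: "nat list set" where
  "Dumont132 = {\<pi>. (\<exists>n. \<pi> \<in> permutations_of_set {1..n}) \<and> dumont \<pi> \<and> avoids \<pi> pat_132}"

text \<open>
  The generating functions are formal power series in \<open>x\<^sub>1\<close> (which is \<^const>\<open>fps_X\<close>); the
  remaining arguments \<open>x\<^sub>2, x\<^sub>3, \<dots>\<close> are the values \<open>x 2, x 3, \<dots>\<close> of a sequence of coefficients
  (the values \<open>x 0\<close> and \<open>x 1\<close> are not used).
  By \<open>occ_eq_0\<close>, all factors of the product with \<open>j\<close> greater than the length of \<open>\<pi>\<close> are 1.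
\<close>

definition B_gf :: "(nat \<Rightarrow> 'a::field) \<Rightarrow> 'a fps" where
  "B_gf x = Abs_fps (\<lambda>n. \<Sum>\<pi> | \<pi> \<in> Dumont132 \<and> length \<pi> = n.
                            \<Prod>j = 2..length \<pi>. x j ^ occ (pat_inc j) \<pi>)"

definition A2 :: "(nat \<Rightarrow> 'a::field) \<Rightarrow> 'a fps" where
  "A2 x = fps_const (1 / 2) * (B_gf x + fps_compose (B_gf x) (- fps_X))"

definition B2 :: "(nat \<Rightarrow> 'a::field) \<Rightarrow> 'a fps" where
  "B2 x = fps_const (1 / 2) * (B_gf x - fps_compose (B_gf x) (- fps_X))"

text \<open>
  The field of rational functions over the rationals in the indeterminates \<open>x\<^sub>j\<close>: a monomial is a
  finitely supported map from indices to exponents, a polynomial is a finitely supported map from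
  monomials to coefficients.
\<close>

type_synonym ratfun = "((nat \<Rightarrow>\<^sub>0 nat) \<Rightarrow>\<^sub>0 rat) fract"

definition indet :: "nat \<Rightarrow> ratfun" where
  "indet j = Fract (Poly_Mapping.single (Poly_Mapping.single j 1) 1) 1"

end

theory Submission
  imports Defs
begin

text \<open>
  Cut a Dumont permutation avoiding 1-3-2 at its maximum \<open>n\<close>: it is \<open>\<alpha> n \<beta>\<close> with every entry of \<open>\<alpha>\<close>
  above every entry of \<open>\<beta>\<close>. For odd \<open>n\<close> the part \<open>\<beta>\<close> is empty and \<open>\<alpha>\<close> is an arbitrary member of
  even size. For even \<open>n\<close> either \<open>\<alpha>\<close> is empty and \<open>\<beta>\<close> has odd size, or \<open>\<alpha>\<close> has (up to a shift by an
  even number) odd size and \<open>\<beta>\<close> has positive even size. No increasing pattern meets both \<open>\<alpha> n\<close> and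
  \<open>\<beta>\<close>, and appending a maximum to a nonempty \<open>\<alpha>\<close> multiplies the weight by \<open>x\<^sub>2\<close> and replaces each
  \<open>x\<^sub>j\<close> by \<open>x\<^sub>j x\<^sub>j\<^sub>+\<^sub>1\<close>. With \<open>y\<^sub>j = x\<^sub>j x\<^sub>j\<^sub>+\<^sub>1\<close> this gives \<open>B(x) = x\<^sub>1 (1 + x\<^sub>2 (A(y) - 1))\<close> and
  \<open>A(x) = 1 + x\<^sub>1 B(x) + x\<^sub>1 x\<^sub>2 B(y) (A(x) - 1)\<close>; solving the latter for \<open>A(x)\<close> gives the fraction.
\<close>

section \<open>Occurrences of patterns\<close>

lemma finite_occurrences [simp]: "finite (occurrences p \<pi>)"
proof (rule finite_subset)
  show "occurrences p \<pi> \<subseteq> {ps. set ps \<subseteq> {..<length \<pi>} \<and> length ps = length (fst p)}"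
    by (auto simp: occurrences_def split: prod.splits)
qed (rule finite_lists_length_eq, simp)

text \<open>The word of the pattern increases, so being order-isomorphic to it means that the
  selected entries increase. Stated with \<open>sorted_wrt\<close>, this splits over
  \<open>@\<close> and \<open>map\<close>.\<close>

lemma mem_occurrences_pat_inc:
  "ps \<in> occurrences (pat_inc j) \<pi> \<longleftrightarrow>
     length ps = j \<and> sorted_wrt (<) ps \<and> set ps \<subseteq> {..<length \<pi>} \<and> ps ! 1 = ps ! 0 + 1 \<and>
     sorted_wrt (<) (map ((!) \<pi>) ps)"
proof -
  have "(\<forall>a<j. \<forall>b<j. \<pi> ! (ps ! a) < \<pi> ! (ps ! b) \<longleftrightarrow> [1..<j + 1] ! a < [1..<j + 1] ! b) \<longleftrightarrow>
        sorted_wrt (<) (map ((!) \<pi>) ps)" if "length ps = j"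
  proof -
    have "(\<forall>a<j. \<forall>b<j. f a < f b \<longleftrightarrow> a < b) \<longleftrightarrow> (\<forall>a b. a < b \<longrightarrow> b < j \<longrightarrow> f a < f b)"
      for f :: "nat \<Rightarrow> nat"
      by (metis less_trans nat_neq_iff)
    from this[of "\<lambda>a. \<pi> ! (ps ! a)"]
    have "(\<forall>a<j. \<forall>b<j. \<pi> ! (ps ! a) < \<pi> ! (ps ! b) \<longleftrightarrow> a < b) \<longleftrightarrow>
          (\<forall>a b. a < b \<longrightarrow> b < j \<longrightarrow> \<pi> ! (ps ! a) < \<pi> ! (ps ! b))" .
    then show ?thesis
      using that by (auto simp: sorted_wrt_iff_nth_less simp del: upt_Suc)
  qed
  then show ?thesis
    by (auto simp: occurrences_def pat_inc_def simp del: upt_Suc)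
qed

section \<open>Avoidance of 1-3-2 under concatenation and shifting\<close>

lemma avoids_132_iff:
  "avoids \<pi> pat_132 \<longleftrightarrow>
     (\<forall>i j k. i < j \<longrightarrow> j < k \<longrightarrow> k < length \<pi> \<longrightarrow> \<not> (\<pi> ! i < \<pi> ! k \<and> \<pi> ! k < \<pi> ! j))"
proof -
  have "ps \<in> occurrences pat_132 \<pi> \<longleftrightarrow> (\<exists>i j k. ps = [i, j, k] \<and> i < j \<and> j < k \<and> k < length \<pi> \<and>
          \<pi> ! i < \<pi> ! k \<and> \<pi> ! k < \<pi> ! j)" for ps
    by (auto simp: occurrences_def pat_132_def length_Suc_conv numeral_3_eq_3 All_less_Suc2
          less_Suc_eq)
  then show ?thesis
    unfolding avoids_def by blast
qed

lemma avoids_132_appendD: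
  assumes "avoids (xs @ ys) pat_132"
  shows "avoids xs pat_132" and "avoids ys pat_132"
proof -
  have *: "\<not> ((xs @ ys) ! i < (xs @ ys) ! k \<and> (xs @ ys) ! k < (xs @ ys) ! j)"
    if "i < j" "j < k" "k < length (xs @ ys)" for i j k
    using assms that unfolding avoids_132_iff by blast
  show "avoids xs pat_132"
    unfolding avoids_132_iff
  proof (intro allI impI)
    fix i j k assume "i < j" "j < k" "k < length xs"
    then show "\<not> (xs ! i < xs ! k \<and> xs ! k < xs ! j)"
      using *[of i j k] by (simp add: nth_append)
  qed
  show "avoids ys pat_132"
    unfolding avoids_132_iff
  proof (intro allI impI)
    fix i j k assume "i < j" "j < k" "k < length ys"
    then show "\<not> (ys ! i < ys ! k \<and> ys ! k < ys ! j)"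
      using *[of "length xs + i" "length xs + j" "length xs + k"] by (simp add: nth_append)
  qed
qed

text \<open>The first letter of 1-3-2 is its least, so an occurrence starting in \<open>xs\<close>
  cannot end in the lower entries of \<open>ys\<close>; any other occurrence lies entirely in
  \<open>ys\<close>.\<close>

lemma avoids_132_skew_sum:
  assumes "avoids xs pat_132" and "avoids ys pat_132" and "\<forall>a\<in>set xs. \<forall>b\<in>set ys. b < a"
  shows "avoids (xs @ ys) pat_132"
  unfolding avoids_132_iff
proof (intro allI impI)
  fix i j k assume ijk: "i < j" "j < k" "k < length (xs @ ys)"
  let ?n = "length xs"
  show "\<not> ((xs @ ys) ! i < (xs @ ys) ! k \<and> (xs @ ys) ! k < (xs @ ys) ! j)"
  proof (cases "i < ?n")
    case True
    show ?thesis
    proof (cases "k < ?n")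
      case True
      with ijk assms(1) show ?thesis
        by (auto simp: avoids_132_iff nth_append)
    next
      case False
      with ijk have "ys ! (k - ?n) \<in> set ys"
        by (intro nth_mem) auto
      then have "ys ! (k - ?n) < xs ! i"
        using assms(3) \<open>i < ?n\<close> nth_mem by blast
      with False True show ?thesis
        by (simp add: nth_append)
    qed
  next
    case False
    with ijk have "i - ?n < j - ?n" "j - ?n < k - ?n" "k - ?n < length ys"
      by auto
    with assms(2) have "\<not> (ys ! (i - ?n) < ys ! (k - ?n) \<and> ys ! (k - ?n) < ys ! (j - ?n))"
      unfolding avoids_132_iff by blast
    with False ijk show ?thesis
      by (simp add: nth_append)
  qed
qed

text \<open>A final maximum could only serve as the letter 2, but the letter 3 before it would have
  to be larger.\<close>

lemma avoids_132_snoc_max: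
  assumes "avoids xs pat_132" and "\<forall>a\<in>set xs. a < m"
  shows "avoids (xs @ [m]) pat_132"
  unfolding avoids_132_iff
proof (intro allI impI)
  fix i j k assume ijk: "i < j" "j < k" "k < length (xs @ [m])"
  then have "xs ! j < m"
    using assms(2) by simp
  then show "\<not> ((xs @ [m]) ! i < (xs @ [m]) ! k \<and> (xs @ [m]) ! k < (xs @ [m]) ! j)"
    using ijk assms(1) by (auto simp: nth_append avoids_132_iff)
qed

text \<open>Occurrences depend only on the relative order of the entries.\<close>

lemma occurrences_map_add: "occurrences p (map ((+) k) \<pi>) = occurrences p \<pi>"
proof (cases p)
  case (Pair w adj)
  have "map ((+) k) \<pi> ! (ps ! a) = k + \<pi> ! (ps ! a)"
    if "length ps = length w" "set ps \<subseteq> {..<length \<pi>}" "a < length w" for ps a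
  proof -
    from that have "ps ! a \<in> set ps" by simp
    with that(2) show ?thesis by (intro nth_map) auto
  qed
  then show ?thesis
    unfolding Pair occurrences_def by (auto intro!: Collect_cong)
qed

lemma occ_map_add: "occ p (map ((+) k) \<pi>) = occ p \<pi>"
  by (simp add: occ_def occurrences_map_add)

lemma avoids_map_add: "avoids (map ((+) k) \<pi>) p \<longleftrightarrow> avoids \<pi> p"
  by (simp add: avoids_def occurrences_map_add)

section \<open>Increasing patterns in composed words\<close>

lemma map_nth_append_left:
  "set ps \<subseteq> {..<length xs} \<Longrightarrow> map ((!) (xs @ ys)) ps = map ((!) xs) ps"
  by (auto simp: nth_append)

lemma occurrences_pat_inc_append_left:
  "occurrences (pat_inc j) (xs @ ys) \<inter> {ps. set ps \<subseteq> {..<length xs}} = occurrences (pat_inc j) xs"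
proof (intro set_eqI)
  fix ps
  have "set ps \<subseteq> {..<length (xs @ ys)}" if "set ps \<subseteq> {..<length xs}"
    using that by force
  then show "ps \<in> occurrences (pat_inc j) (xs @ ys) \<inter> {ps. set ps \<subseteq> {..<length xs}} \<longleftrightarrow>
      ps \<in> occurrences (pat_inc j) xs"
    unfolding Int_iff mem_occurrences_pat_inc mem_Collect_eq using map_nth_append_left by metis
qed

text \<open>An increasing subsequence that starts in \<open>xs\<close> cannot continue into the
  lower entries of \<open>ys\<close>.\<close>

lemma occurrences_pat_inc_skew_sum:
  assumes less: "\<forall>a\<in>set xs. \<forall>b\<in>set ys. b < a" and j: "j \<ge> 2"
  shows "occurrences (pat_inc j) (xs @ ys) =
           occurrences (pat_inc j) xs \<union> map ((+) (length xs)) ` occurrences (pat_inc j) ys"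
    (is "?L = ?A \<union> ?f ` ?B")
proof (intro equalityI subsetI)
  let ?n = "length xs"
  fix ps assume ps: "ps \<in> ?L"
  then have len: "length ps = j" and srt: "sorted_wrt (<) ps"
    and sub: "set ps \<subseteq> {..<length (xs @ ys)}" and adj: "ps ! 1 = ps ! 0 + 1"
    and inc: "sorted_wrt (<) (map ((!) (xs @ ys)) ps)"
    by (auto simp only: mem_occurrences_pat_inc)
  obtain q qs where q: "ps = q # qs"
    using len j by (cases ps) auto
  show "ps \<in> ?A \<union> ?f ` ?B"
  proof (cases "q < ?n")
    case True
    have "p < ?n" if "p \<in> set qs" for p
    proof (rule ccontr)
      assume "\<not> p < ?n"
      have "p < length (xs @ ys)"
        using sub that q by auto
      with \<open>\<not> p < ?n\<close> have "ys ! (p - ?n) \<in> set ys"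
        by (intro nth_mem) auto
      then have "ys ! (p - ?n) < xs ! q"
        using less True by simp
      moreover have "(xs @ ys) ! q < (xs @ ys) ! p"
        using inc that q by auto
      ultimately show False
        using True \<open>\<not> p < ?n\<close> by (simp add: nth_append)
    qed
    then have "set ps \<subseteq> {..<?n}"
      using True q by auto
    with ps occurrences_pat_inc_append_left show ?thesis
      by blast
  next
    case False
    then have ge: "\<forall>p\<in>set ps. ?n \<le> p"
      using srt q by auto
    define rs where "rs = map (\<lambda>p. p - ?n) ps"
    have ps_eq: "ps = ?f rs"
      unfolding rs_def using ge by (simp add: map_idI)
    have "length rs = j"
      using len by (simp add: rs_def)
    moreover have "sorted_wrt (<) rs"
      using srt unfolding ps_eq by (simp add: sorted_wrt_map)
    moreover have "set rs \<subseteq> {..<length ys}"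
      using sub unfolding ps_eq by auto
    moreover have "rs ! 1 = rs ! 0 + 1"
      using adj j \<open>length rs = j\<close> unfolding ps_eq by simp
    moreover have "sorted_wrt (<) (map ((!) ys) rs)"
      using inc unfolding ps_eq by (simp add: sorted_wrt_map)
    ultimately have "rs \<in> ?B"
      by (simp add: mem_occurrences_pat_inc)
    then show ?thesis
      using ps_eq by blast
  qed
next
  fix ps assume "ps \<in> ?A \<union> ?f ` ?B"
  then show "ps \<in> ?L"
  proof
    assume "ps \<in> ?A"
    then show ?thesis
      using occurrences_pat_inc_append_left by blast
  next
    assume "ps \<in> ?f ` ?B"
    then obtain rs where "ps = ?f rs" "rs \<in> ?B"
      by blast
    then show ?thesis
      using j by (auto simp: mem_occurrences_pat_inc sorted_wrt_map)
  qed
qed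

lemma occ_pat_inc_skew_sum:
  assumes less: "\<forall>a\<in>set xs. \<forall>b\<in>set ys. b < a" and j: "j \<ge> 2"
  shows "occ (pat_inc j) (xs @ ys) = occ (pat_inc j) xs + occ (pat_inc j) ys"
proof -
  let ?f = "map ((+) (length xs))"
  \<comment> \<open>Each occurrence has a first position, which is below \<open>length xs\<close> in
    one family and not in the other.\<close>
  have "occurrences (pat_inc j) xs \<inter> ?f ` occurrences (pat_inc j) ys = {}"
  proof -
    have False if "ps \<in> occurrences (pat_inc j) xs" "ps = ?f rs" for ps rs
    proof -
      have "ps ! 0 \<in> set ps"
        using that(1) j by (intro nth_mem) (auto simp: mem_occurrences_pat_inc)
      with that show False
        by (auto simp: mem_occurrences_pat_inc)
    qed
    then show ?thesis by blast
  qed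
  moreover have "card (?f ` occurrences (pat_inc j) ys) = card (occurrences (pat_inc j) ys)"
    by (intro card_image inj_onI) (auto simp: inj_map_eq_map)
  ultimately show ?thesis
    by (simp add: occ_def occurrences_pat_inc_skew_sum[OF assms] card_Un_disjoint)
qed

text \<open>An occurrence through the new last position is one of the pattern with one letter less,
  extended by that position. For \<open>j = 2\<close> the missing dash instead forces the other
  position to be \<open>length xs - 1\<close>, hence the separate case.\<close>

lemma occurrences_pat_inc_snoc_max:
  assumes "\<forall>a\<in>set xs. a < m" and j: "j \<ge> 2"
  shows "occurrences (pat_inc j) (xs @ [m]) = occurrences (pat_inc j) xs \<union>
    (if j = 2 then if xs = [] then {} else {[length xs - 1, length xs]}
     else (\<lambda>ps. ps @ [length xs]) ` occurrences (pat_inc (j - 1)) xs)"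
    (is "?L = ?A \<union> ?B")
proof -
  let ?n = "length xs"
  \<comment> \<open>As \<open>m\<close> exceeds all entries of \<open>xs\<close>, the comparisons
    with it hold automatically.\<close>
  have last: "qs @ [?n] \<in> ?L \<longleftrightarrow> length qs = j - 1 \<and> sorted_wrt (<) qs \<and> set qs \<subseteq> {..<?n} \<and>
      (qs @ [?n]) ! 1 = (qs @ [?n]) ! 0 + 1 \<and> sorted_wrt (<) (map ((!) xs) qs)" for qs
  proof -
    have "sorted_wrt (<) (map ((!) (xs @ [m])) (qs @ [?n])) \<longleftrightarrow> sorted_wrt (<) (map ((!) xs) qs)"
      if "set qs \<subseteq> {..<?n}"
    proof -
      have "\<forall>p\<in>set qs. xs ! p < m"
        using that assms(1) by auto
      then show ?thesis
        by (simp add: map_nth_append_left[OF that] sorted_wrt_append del: map_eq_conv)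
    qed
    then show ?thesis
      using j by (auto simp: mem_occurrences_pat_inc sorted_wrt_append)
  qed
  have B: "qs @ [?n] \<in> ?L \<longleftrightarrow> qs @ [?n] \<in> ?B" for qs
  proof (cases "j = 2")
    case True
    then show ?thesis
      unfolding last by (cases qs) auto
  next
    case False
    with j have "qs @ [?n] \<in> ?L \<longleftrightarrow> qs \<in> occurrences (pat_inc (j - 1)) xs"
      unfolding last by (auto simp: mem_occurrences_pat_inc nth_append)
    with False show ?thesis
      by auto
  qed
  have nB: "\<exists>qs. ps = qs @ [?n]" if "ps \<in> ?B" for ps
    using that by (auto split: if_splits intro: exI[of _ "[?n - 1]"])
  show ?thesis
  proof (intro equalityI subsetI)
    fix ps assume ps: "ps \<in> ?L"
    then obtain qs p where q: "ps = qs @ [p]"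
      using j by (cases ps rule: rev_cases) (auto simp: mem_occurrences_pat_inc)
    show "ps \<in> ?A \<union> ?B"
    proof (cases "p = ?n")
      case True
      then show ?thesis
        using B ps q by blast
    next
      case False
      then have "set ps \<subseteq> {..<?n}"
        using ps q by (force simp: mem_occurrences_pat_inc sorted_wrt_append)
      then show ?thesis
        using ps occurrences_pat_inc_append_left by blast
    qed
  next
    fix ps assume "ps \<in> ?A \<union> ?B"
    then show "ps \<in> ?L"
      using occurrences_pat_inc_append_left B nB by blast
  qed
qed

text \<open>The summand with \<open>j - 1\<close> is the source of the substitution of
  \<open>x j * x (j + 1)\<close> for \<open>x j\<close>.\<close>

lemma occ_pat_inc_snoc_max:
  assumes "\<forall>a\<in>set xs. a < m" and j: "j \<ge> 2"
  shows "occ (pat_inc j) (xs @ [m]) = occ (pat_inc j) xs +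
    (if j = 2 then if xs = [] then 0 else 1 else occ (pat_inc (j - 1)) xs)"
proof -
  have "occurrences (pat_inc j) xs \<inter>
    (if j = 2 then if xs = [] then {} else {[length xs - 1, length xs]}
     else (\<lambda>ps. ps @ [length xs]) ` occurrences (pat_inc (j - 1)) xs) = {}"
    by (auto simp: mem_occurrences_pat_inc)
  moreover have "card ((\<lambda>ps. ps @ [length xs]) ` A) = card A" for A
    by (intro card_image inj_onI) auto
  ultimately show ?thesis
    by (simp add: occ_def occurrences_pat_inc_snoc_max[OF assms] card_Un_disjoint)
qed

section \<open>The weight of a permutation\<close>

text \<open>The contribution of one permutation to \<open>B_gf\<close>, isolated so that it also
  applies to words that are not permutations of an initial segment, such as the entries before the
  maximum.\<close>

definition weight :: "(nat \<Rightarrow> 'a::field) \<Rightarrow> nat list \<Rightarrow> 'a" where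
  "weight x \<pi> = (\<Prod>j = 2..length \<pi>. x j ^ occ (pat_inc j) \<pi>)"

lemma occ_pat_inc_eq_0: "length \<pi> < j \<Longrightarrow> occ (pat_inc j) \<pi> = 0"
  by (rule occ_eq_0) (simp add: pat_inc_def)

text \<open>The added factors have exponent 0; a common upper bound makes words of different lengths
  comparable.\<close>

lemma weight_upto:
  assumes "length \<pi> \<le> N"
  shows "weight x \<pi> = (\<Prod>j = 2..N. x j ^ occ (pat_inc j) \<pi>)"
  unfolding weight_def
  using assms by (intro prod.mono_neutral_left) (auto simp: occ_pat_inc_eq_0)

lemma weight_skew_sum:
  assumes "\<forall>a\<in>set xs. \<forall>b\<in>set ys. b < a"
  shows "weight x (xs @ ys) = weight x xs * weight x ys"
proof -
  have "weight x (xs @ ys) = (\<Prod>j = 2..length (xs @ ys).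
          x j ^ occ (pat_inc j) xs * x j ^ occ (pat_inc j) ys)"
    unfolding weight_def
    by (intro prod.cong refl) (simp add: occ_pat_inc_skew_sum[OF assms] power_add)
  then show ?thesis
    by (simp add: prod.distrib weight_upto[of xs "length xs + length ys"]
          weight_upto[of ys "length xs + length ys"])
qed

lemma weight_map_add: "weight x (map ((+) k) \<pi>) = weight x \<pi>"
  by (simp add: weight_def occ_map_add)

lemma weight_Nil [simp]: "weight x [] = 1"
  and weight_single [simp]: "weight x [m] = 1"
  by (simp_all add: weight_def)

text \<open>For \<open>j > 2\<close> the new occurrences of \<open>pat_inc j\<close> come from those
  of \<open>pat_inc (j - 1)\<close> in \<open>xs\<close>, so after reindexing each power of
  \<open>x j\<close> is joined by the same power of \<open>x (j + 1)\<close>. The single new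
  occurrence for \<open>j = 2\<close> gives the factor \<open>x 2\<close>.\<close>

lemma weight_snoc_max:
  assumes "\<forall>a\<in>set xs. a < m" and "xs \<noteq> []"
  shows "weight x (xs @ [m]) = x 2 * weight (\<lambda>j. x j * x (j + 1)) xs"
proof -
  define N where "N = length xs"
  define f where "f j = occ (pat_inc j) xs" for j
  have N: "N \<ge> 1"
    using assms(2) by (simp add: N_def Suc_le_eq)
  have split: "(\<Prod>j = 2..Suc N. g j) = g 2 * (\<Prod>j = 2..N. g (Suc j))" for g :: "nat \<Rightarrow> 'a"
  proof -
    have "(\<Prod>j = 2..Suc N. g j) = g 2 * (\<Prod>j = Suc 2..Suc N. g j)"
      using N by (intro prod.atLeast_Suc_atMost) simp
    then show ?thesis
      by (simp only: prod.shift_bounds_cl_Suc_ivl)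
  qed
  have "weight x (xs @ [m]) =
      (\<Prod>j = 2..Suc N. x j ^ f j * x j ^ (if j = 2 then 1 else f (j - 1)))"
    unfolding weight_def
    using assms by (intro prod.cong) (simp_all add: occ_pat_inc_snoc_max f_def N_def power_add)
  also have "\<dots> = (\<Prod>j = 2..Suc N. x j ^ f j) *
      (\<Prod>j = 2..Suc N. x j ^ (if j = 2 then 1 else f (j - 1)))"
    by (rule prod.distrib)
  \<comment> \<open>The factor at \<open>Suc N\<close> is 1, since \<open>xs\<close> has only
    \<open>N\<close> letters.\<close>
  also have "(\<Prod>j = 2..Suc N. x j ^ f j) = (\<Prod>j = 2..N. x j ^ f j)"
    using weight_upto[of xs "Suc N" x] weight_upto[of xs N x] by (simp add: f_def N_def)
  also have "(\<Prod>j = 2..Suc N. x j ^ (if j = 2 then 1 else f (j - 1))) =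
      x 2 * (\<Prod>j = 2..N. x (Suc j) ^ f j)"
    unfolding split by (auto intro!: prod.cong)
  finally show ?thesis
    by (simp add: weight_def f_def N_def prod.distrib power_mult_distrib mult_ac)
qed

section \<open>Decomposition of Dumont permutations around the maximum\<close>

definition dumont_step :: "nat \<Rightarrow> nat \<Rightarrow> bool" where
  "dumont_step a b \<longleftrightarrow> (if even a then b < a else a < b)"

lemma dumont_Nil [simp]: "dumont []"
  by (simp add: dumont_def)

lemma dumont_single [simp]: "dumont [a] \<longleftrightarrow> odd a"
  by (simp add: dumont_def)

lemma dumont_Cons_Cons: "dumont (a # b # \<pi>) \<longleftrightarrow> dumont_step a b \<and> dumont (b # \<pi>)"
  unfolding dumont_def by (subst length_Cons, subst All_less_Suc2) (auto simp: dumont_step_def)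

text \<open>An even last letter would lack a smaller successor. In this form the condition can be
  split at any place of the word.\<close>

lemma dumont_iff_successively:
  "dumont \<pi> \<longleftrightarrow> successively dumont_step \<pi> \<and> (\<pi> \<noteq> [] \<longrightarrow> odd (last \<pi>))"
  by (induction dumont_step \<pi> rule: successively.induct) (auto simp: dumont_Cons_Cons)

text \<open>The last letter of \<open>\<alpha>\<close> ascends to \<open>m\<close>, so it is odd,
  which is just what \<open>dumont \<alpha>\<close> asks of it. The maximum is even if a letter
  follows, since that letter is smaller, and odd if it comes last.\<close>

lemma dumont_append_max_Cons:
  assumes "\<forall>a\<in>set \<alpha>. a < m" and "\<forall>b\<in>set \<beta>. b < m"
  shows "dumont (\<alpha> @ m # \<beta>) \<longleftrightarrow> dumont \<alpha> \<and> dumont \<beta> \<and> (even m \<longleftrightarrow> \<beta> \<noteq> [])"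
proof -
  have \<alpha>: "dumont_step (last \<alpha>) m \<longleftrightarrow> odd (last \<alpha>)" if "\<alpha> \<noteq> []"
  proof -
    have "last \<alpha> < m"
      using assms(1) that last_in_set by blast
    then show ?thesis
      by (simp add: dumont_step_def)
  qed
  have \<beta>: "dumont_step m (hd \<beta>) \<longleftrightarrow> even m" if "\<beta> \<noteq> []"
  proof -
    have "hd \<beta> < m"
      using assms(2) that hd_in_set by blast
    then show ?thesis
      by (simp add: dumont_step_def)
  qed
  from \<alpha> \<beta> show ?thesis
    by (auto simp: dumont_iff_successively successively_append_iff successively_Cons)
qed

text \<open>An even shift preserves all parities, hence the parity conditions on \<open>k\<close> in
  the decomposition.\<close>

lemma dumont_map_add: "even k \<Longrightarrow> dumont (map ((+) k) \<pi>) \<longleftrightarrow> dumont \<pi>"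
  by (auto simp: dumont_iff_successively successively_map last_map dumont_step_def)

text \<open>An even letter is followed by a smaller one, so it cannot be least.\<close>

lemma dumont_least_odd:
  assumes "dumont \<pi>" and "c \<in> set \<pi>" and "\<forall>a\<in>set \<pi>. c \<le> a"
  shows "odd c"
proof -
  obtain i where "i < length \<pi>" "c = \<pi> ! i"
    using assms(2) by (auto simp: in_set_conv_nth)
  with assms(1,3) show ?thesis
    unfolding dumont_def by (meson leD nth_mem)
qed

section \<open>Dumont permutations of fixed size avoiding 1-3-2\<close>

definition dumont132_of_size :: "nat \<Rightarrow> nat list set" where
  "dumont132_of_size n = {\<pi>. \<pi> \<in> permutations_of_set {1..n} \<and> dumont \<pi> \<and> avoids \<pi> pat_132}"

lemma finite_dumont132_of_size [simp]: "finite (dumont132_of_size n)"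
  unfolding dumont132_of_size_def
  by (rule finite_subset[OF _ finite_permutations_of_set[of "{1..n}"]]) auto

lemma dumont132_of_size_eq: "{\<pi>. \<pi> \<in> Dumont132 \<and> length \<pi> = n} = dumont132_of_size n"
proof -
  have "m = length \<pi>" if "\<pi> \<in> permutations_of_set {1..m}" for \<pi> m
    using length_finite_permutations_of_set[OF that] by simp
  then show ?thesis
    unfolding Dumont132_def dumont132_of_size_def by blast
qed

lemma dumont132_of_size_iff:
  "\<pi> \<in> dumont132_of_size n \<longleftrightarrow> distinct \<pi> \<and> set \<pi> = {1..n} \<and> dumont \<pi> \<and> avoids \<pi> pat_132"
  by (auto simp: dumont132_of_size_def permutations_of_set_def)

lemma length_dumont132_of_size: "\<pi> \<in> dumont132_of_size n \<Longrightarrow> length \<pi> = n"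
  by (auto simp: dumont132_of_size_iff dest: distinct_card)

lemma dumont132_of_size_0: "dumont132_of_size 0 = {[]}"
  by (auto simp: dumont132_of_size_iff avoids_132_iff)

text \<open>Converse of the cut at the maximum. Raising \<open>\<alpha>\<close> by \<open>k\<close>
  is harmless if \<open>k\<close> is even or \<open>\<alpha>\<close> is empty; \<open>parity\<close>
  says that the maximum is even exactly when \<open>\<beta>\<close> is nonempty.\<close>

lemma mem_dumont132_of_size_join:
  assumes \<alpha>: "\<alpha> \<in> dumont132_of_size a" and \<beta>: "\<beta> \<in> dumont132_of_size k"
    and n: "n = Suc (a + k)" and k: "even k \<or> a = 0" and parity: "even n \<longleftrightarrow> k \<noteq> 0"
  shows "map ((+) k) \<alpha> @ n # \<beta> \<in> dumont132_of_size n"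
proof -
  have set\<alpha>: "set (map ((+) k) \<alpha>) = {k + 1..k + a}"
    using \<alpha> by (simp add: dumont132_of_size_iff image_add_atLeastAtMost)
  have set\<beta>: "set \<beta> = {1..k}"
    using \<beta> by (simp add: dumont132_of_size_iff)
  have "dumont (map ((+) k) \<alpha>)"
    using k \<alpha> by (auto simp: dumont_map_add dumont132_of_size_iff)
  moreover have "\<beta> \<noteq> [] \<longleftrightarrow> k \<noteq> 0"
    using length_dumont132_of_size[OF \<beta>] by auto
  moreover have "dumont \<beta>"
    using \<beta> by (simp add: dumont132_of_size_iff)
  ultimately have "dumont (map ((+) k) \<alpha> @ n # \<beta>)"
    using parity n by (subst dumont_append_max_Cons) (unfold set\<alpha> set\<beta>, auto)
  \<comment> \<open>Taking the maximum into the left block puts that whole block above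
    \<open>\<beta>\<close>.\<close>
  moreover have "avoids ((map ((+) k) \<alpha> @ [n]) @ \<beta>) pat_132"
    using \<alpha> \<beta> n set\<alpha> set\<beta>
    by (intro avoids_132_skew_sum avoids_132_snoc_max)
       (simp_all add: dumont132_of_size_iff avoids_map_add)
  moreover have "distinct (map ((+) k) \<alpha> @ n # \<beta>)"
    using \<alpha> \<beta> n by (auto simp: dumont132_of_size_iff distinct_map)
  moreover have "set (map ((+) k) \<alpha> @ n # \<beta>) = {1..n}"
    unfolding set_append set\<alpha> set\<beta> list.set using n by auto
  ultimately show ?thesis
    by (simp add: dumont132_of_size_iff)
qed

text \<open>If the part of size \<open>k\<close> after the maximum were of odd size, the least entry \<open>k + 1\<close> of the
  part before the maximum would be even, and nothing there could follow it.\<close>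

lemma dumont132_of_size_split:
  assumes \<pi>: "\<pi> \<in> dumont132_of_size n" and n: "n > 0"
  obtains k \<alpha> \<beta> where "k < n" "\<alpha> \<in> dumont132_of_size (n - 1 - k)" "\<beta> \<in> dumont132_of_size k"
    "\<pi> = map ((+) k) \<alpha> @ n # \<beta>" "even k \<or> \<alpha> = []" "even n \<longleftrightarrow> k \<noteq> 0"
proof -
  have dist: "distinct \<pi>" and set: "set \<pi> = {1..n}" and dum: "dumont \<pi>" and av: "avoids \<pi> pat_132"
    using \<pi> by (auto simp: dumont132_of_size_iff)
  have "n \<in> set \<pi>"
    using set n by simp
  then obtain \<gamma> \<beta> where split: "\<pi> = \<gamma> @ n # \<beta>"
    by (meson split_list)
  define k where "k = length \<beta>"
  have un: "set \<gamma> \<union> set \<beta> = {1..<n}"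
  proof -
    have "set \<gamma> \<union> set \<beta> = {1..n} - {n}"
      using set dist unfolding split by auto
    also have "\<dots> = {1..<n}" by auto
    finally show ?thesis .
  qed
  \<comment> \<open>If \<open>a < b\<close>, then \<open>a\<close>, \<open>n\<close>,
    \<open>b\<close> would form 1-3-2.\<close>
  have lt: "b < a" if ab: "a \<in> set \<gamma>" "b \<in> set \<beta>" for a b
  proof (rule ccontr)
    assume "\<not> b < a"
    moreover have "a \<noteq> b"
      using dist ab unfolding split by auto
    ultimately have "a < b" by simp
    obtain i where i: "i < length \<gamma>" "\<gamma> ! i = a"
      using ab by (auto simp: in_set_conv_nth)
    obtain l where l: "l < length \<beta>" "\<beta> ! l = b"
      using ab by (auto simp: in_set_conv_nth)
    have "b < n"
      using un ab by auto
    have "length \<gamma> + Suc l < length \<pi>"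
      using l by (simp add: split)
    moreover have "length \<gamma> < length \<gamma> + Suc l"
      by simp
    ultimately have "\<not> (\<pi> ! i < \<pi> ! (length \<gamma> + Suc l) \<and> \<pi> ! (length \<gamma> + Suc l) < \<pi> ! length \<gamma>)"
      using av i(1) unfolding avoids_132_iff by blast
    then show False
      using i l \<open>a < b\<close> \<open>b < n\<close> by (simp add: split nth_append)
  qed
  have card: "card (set \<beta>) = k" "card (set \<gamma>) = n - 1 - k"
  proof -
    show "card (set \<beta>) = k"
      using dist by (simp add: split k_def distinct_card)
    have "card (set \<gamma>) = length \<gamma>"
      using dist by (simp add: split distinct_card)
    moreover have "length \<pi> = n"
      using \<pi> by (rule length_dumont132_of_size)
    ultimately show "card (set \<gamma>) = n - 1 - k"
      by (simp add: split k_def)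
  qed
  have "k < n"
    using length_dumont132_of_size[OF \<pi>] by (simp add: split k_def)
  have set\<beta>: "set \<beta> = {1..k}"
  proof -
    \<comment> \<open>The value \<open>c\<close> occurs in \<open>\<gamma>\<close> or
      \<open>\<beta>\<close>, and in \<open>\<gamma>\<close> it would exceed \<open>b\<close>. Being
      closed downwards, \<open>set \<beta>\<close> is an initial segment.\<close>
    have down: "c \<in> set \<beta>" if "b \<in> set \<beta>" "1 \<le> c" "c \<le> b" for b c
    proof -
      have "b < n" using un that by auto
      then have "c \<in> set \<gamma> \<union> set \<beta>" using un that by auto
      then show ?thesis using lt that by force
    qed
    show ?thesis
    proof (cases "\<beta> = []")
      case True
      then show ?thesis by (simp add: k_def)
    next
      case False
      define M where "M = Max (set \<beta>)"
      have "M \<in> set \<beta>" "\<forall>b\<in>set \<beta>. b \<le> M"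
        using False by (auto simp: M_def)
      moreover have "1 \<le> b" if "b \<in> set \<beta>" for b
      proof -
        have "b \<in> {1..<n}"
          using un that by blast
        then show ?thesis by simp
      qed
      ultimately have "c \<in> set \<beta> \<longleftrightarrow> c \<in> {1..M}" for c
        using down[of M c] unfolding atLeastAtMost_iff by blast
      then have "set \<beta> = {1..M}"
        by blast
      then show ?thesis
        using card by simp
    qed
  qed
  have set\<gamma>: "set \<gamma> = {k + 1..<n}"
  proof -
    have "set \<gamma> \<inter> set \<beta> = {}"
      using dist by (auto simp: split)
    with un have "set \<gamma> = {1..<n} - {1..k}"
      unfolding set\<beta> by blast
    also have "\<dots> = {k + 1..<n}"
      by auto
    finally show ?thesis .
  qed
  define \<alpha> where "\<alpha> = map (\<lambda>a. a - k) \<gamma>"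
  have \<gamma>: "\<gamma> = map ((+) k) \<alpha>"
  proof -
    have "k + (a - k) = a" if "a \<in> set \<gamma>" for a
      using that unfolding set\<gamma> by simp
    then show ?thesis
      by (simp add: \<alpha>_def map_idI)
  qed
  have "\<forall>a\<in>set \<gamma>. a < n" "\<forall>b\<in>set \<beta>. b < n"
    unfolding set\<gamma> set\<beta> using \<open>k < n\<close> by auto
  then have d: "dumont \<gamma>" "dumont \<beta>" "even n \<longleftrightarrow> \<beta> \<noteq> []"
    using dum unfolding split by (simp_all add: dumont_append_max_Cons)
  have even: "even k \<or> \<gamma> = []"
  proof (rule disjCI)
    assume "\<gamma> \<noteq> []"
    then have "k + 1 \<in> set \<gamma>"
      using set_empty[of \<gamma>] unfolding set\<gamma> by simp
    moreover have "\<forall>a\<in>set \<gamma>. k + 1 \<le> a"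
      unfolding set\<gamma> by simp
    ultimately have "odd (k + 1)"
      by (rule dumont_least_odd[OF d(1)])
    then show "even k" by simp
  qed
  show thesis
  proof (rule that[of k \<alpha> \<beta>])
    have "set \<alpha> = {1..n - 1 - k}"
    proof -
      have "(+) k ` set \<alpha> = (+) k ` {1..n - 1 - k}"
        using set\<gamma> \<open>k < n\<close> unfolding \<gamma> set_map image_add_atLeastAtMost by auto
      then show ?thesis
        by (subst (asm) inj_image_eq_iff) simp_all
    qed
    moreover have "distinct \<alpha>"
      using dist by (simp add: split \<gamma> distinct_map)
    moreover have "dumont \<alpha>"
      using d(1) even by (auto simp: \<gamma> dumont_map_add)
    moreover have "avoids \<alpha> pat_132"
      using av avoids_132_appendD(1)[of \<gamma> "n # \<beta>"] by (simp add: split \<gamma> avoids_map_add)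
    ultimately show "\<alpha> \<in> dumont132_of_size (n - 1 - k)"
      by (simp add: dumont132_of_size_iff)
    have "avoids \<beta> pat_132"
      using av avoids_132_appendD(2)[of "\<gamma> @ [n]" \<beta>] by (simp add: split)
    then show "\<beta> \<in> dumont132_of_size k"
      using dist d set\<beta> by (simp add: dumont132_of_size_iff split)
    show "\<pi> = map ((+) k) \<alpha> @ n # \<beta>"
      by (simp add: split \<gamma>)
    show "even k \<or> \<alpha> = []"
      using even by (simp add: \<alpha>_def)
    show "even n \<longleftrightarrow> k \<noteq> 0"
      using d by (simp add: k_def)
  qed fact
qed

text \<open>An odd maximum cannot be followed by a smaller entry, so it stands last.\<close>

lemma dumont132_of_size_odd:
  assumes "odd n"
  shows "dumont132_of_size n = (\<lambda>\<alpha>. \<alpha> @ [n]) ` dumont132_of_size (n - 1)"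
proof (intro equalityI subsetI)
  fix \<pi> assume "\<pi> \<in> dumont132_of_size n"
  moreover have "n > 0"
    using assms by (rule odd_pos)
  ultimately obtain k \<alpha> \<beta> where *: "\<alpha> \<in> dumont132_of_size (n - 1 - k)"
    "\<beta> \<in> dumont132_of_size k" "\<pi> = map ((+) k) \<alpha> @ n # \<beta>" "even n \<longleftrightarrow> k \<noteq> 0"
    by (rule dumont132_of_size_split)
  then have "k = 0"
    using assms by simp
  with * have "\<alpha> \<in> dumont132_of_size (n - 1)" "\<pi> = \<alpha> @ [n]"
    by (simp_all add: dumont132_of_size_0 map_idI)
  then show "\<pi> \<in> (\<lambda>\<alpha>. \<alpha> @ [n]) ` dumont132_of_size (n - 1)"
    by blast
next
  fix \<pi> assume "\<pi> \<in> (\<lambda>\<alpha>. \<alpha> @ [n]) ` dumont132_of_size (n - 1)"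
  then obtain \<alpha> where "\<alpha> \<in> dumont132_of_size (n - 1)" "\<pi> = \<alpha> @ [n]"
    by blast
  then show "\<pi> \<in> dumont132_of_size n"
    using mem_dumont132_of_size_join[of \<alpha> "n - 1" "[]" 0 n] assms odd_pos[OF assms]
    by (simp add: dumont132_of_size_0 map_idI)
qed

text \<open>If the maximum comes first, the part after it has odd size \<open>n - 1\<close>.
  Otherwise \<open>k\<close> is even and \<open>n - 1 - k\<close> is odd, so the part before the
  maximum is nonempty and the two cases do not overlap.\<close>

lemma dumont132_of_size_even:
  assumes "even n" and "n > 0"
  shows "dumont132_of_size n = (#) n ` dumont132_of_size (n - 1) \<union>
    (\<lambda>(k, \<alpha>, \<beta>). map ((+) k) \<alpha> @ n # \<beta>) `
      (SIGMA k:{k. even k \<and> 0 < k \<and> k < n}. dumont132_of_size (n - 1 - k) \<times> dumont132_of_size k)"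
    (is "_ = ?A \<union> ?B")
proof (intro equalityI subsetI)
  fix \<pi> assume "\<pi> \<in> dumont132_of_size n"
  then obtain k \<alpha> \<beta> where *: "k < n" "\<alpha> \<in> dumont132_of_size (n - 1 - k)"
    "\<beta> \<in> dumont132_of_size k" "\<pi> = map ((+) k) \<alpha> @ n # \<beta>" "even k \<or> \<alpha> = []" "even n \<longleftrightarrow> k \<noteq> 0"
    using assms(2) by (rule dumont132_of_size_split)
  show "\<pi> \<in> ?A \<union> ?B"
  proof (cases "\<alpha> = []")
    case True
    then have "k = n - 1"
      using *(1) length_dumont132_of_size[OF *(2)] by simp
    with True * show ?thesis by simp
  next
    case False
    with * assms have "(k, \<alpha>, \<beta>) \<in> (SIGMA k:{k. even k \<and> 0 < k \<and> k < n}.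
        dumont132_of_size (n - 1 - k) \<times> dumont132_of_size k)"
      by simp
    then have "\<pi> \<in> ?B"
      unfolding *(4) by (rule rev_image_eqI) simp
    then show ?thesis by blast
  qed
next
  fix \<pi> assume "\<pi> \<in> ?A \<union> ?B"
  then show "\<pi> \<in> dumont132_of_size n"
  proof
    assume "\<pi> \<in> ?A"
    then obtain \<beta> where "\<beta> \<in> dumont132_of_size (n - 1)" "\<pi> = n # \<beta>"
      by blast
    moreover have "n \<noteq> 1"
      using assms by auto
    ultimately show ?thesis
      using mem_dumont132_of_size_join[of "[]" 0 \<beta> "n - 1" n] assms
      by (simp add: dumont132_of_size_0)
  next
    assume "\<pi> \<in> ?B"
    then show ?thesis
      using assms by (auto intro!: mem_dumont132_of_size_join)
  qed
qed

section \<open>Recurrences for the generating functions\<close>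

unbundle fps_syntax

section \<open>Recurrences for single coefficients\<close>

definition dumont132_sum :: "(nat \<Rightarrow> 'a::field) \<Rightarrow> nat \<Rightarrow> 'a" where
  "dumont132_sum x n = (\<Sum>\<pi>\<in>dumont132_of_size n. weight x \<pi>)"

lemma B_gf_nth: "B_gf x $ n = dumont132_sum x n"
  by (simp add: B_gf_def dumont132_sum_def dumont132_of_size_eq weight_def)

lemma dumont132_sum_0 [simp]: "dumont132_sum x 0 = 1"
  by (simp add: dumont132_sum_def dumont132_of_size_0)

text \<open>For \<open>n = 1\<close> nothing precedes the maximum and no 12 arises, so the factor
  \<open>x 2\<close> is absent; this exception becomes the term \<open>1 - x2\<close> in the
  theorem.\<close>

lemma dumont132_sum_odd:
  assumes "odd n"
  shows "dumont132_sum x n =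
    (if n = 1 then 1 else x 2 * dumont132_sum (\<lambda>j. x j * x (j + 1)) (n - 1))"
proof (cases "n = 1")
  case True
  then show ?thesis
    by (simp add: dumont132_sum_def dumont132_of_size_odd dumont132_of_size_0)
next
  case False
  have "dumont132_sum x n = (\<Sum>\<alpha>\<in>dumont132_of_size (n - 1). weight x (\<alpha> @ [n]))"
    unfolding dumont132_sum_def dumont132_of_size_odd[OF assms]
    by (subst sum.reindex) (auto intro!: inj_onI)
  also have "\<dots> = (\<Sum>\<alpha>\<in>dumont132_of_size (n - 1). x 2 * weight (\<lambda>j. x j * x (j + 1)) \<alpha>)"
  proof (intro sum.cong refl weight_snoc_max)
    fix \<alpha> assume \<alpha>: "\<alpha> \<in> dumont132_of_size (n - 1)"
    show "\<forall>a\<in>set \<alpha>. a < n"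
      using \<alpha> odd_pos[OF assms] by (auto simp: dumont132_of_size_iff)
    show "\<alpha> \<noteq> []"
      using length_dumont132_of_size[OF \<alpha>] False odd_pos[OF assms] by auto
  qed
  finally show ?thesis
    using False by (simp add: dumont132_sum_def sum_distrib_left)
qed

text \<open>The first term belongs to a leading maximum, which starts no increasing pattern. In the
  sum, \<open>k\<close> is the size of the part after the maximum; both parts vary independently and
  their weights multiply.\<close>

lemma dumont132_sum_even:
  assumes "even n" and "n > 0"
  shows "dumont132_sum x n = dumont132_sum x (n - 1) +
    (\<Sum>k | even k \<and> 0 < k \<and> k < n.
       x 2 * dumont132_sum (\<lambda>j. x j * x (j + 1)) (n - 1 - k) * dumont132_sum x k)"
proof -
  define K where "K = {k. even k \<and> 0 < k \<and> k < n}"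
  define S where "S = (SIGMA k:K. dumont132_of_size (n - 1 - k) \<times> dumont132_of_size k)"
  define h where "h = (\<lambda>(k, \<alpha>, \<beta>). map ((+) k) \<alpha> @ n # \<beta>)"
  have D: "dumont132_of_size n = (#) n ` dumont132_of_size (n - 1) \<union> h ` S"
    unfolding h_def S_def K_def by (rule dumont132_of_size_even[OF assms])
  have "finite K"
    by (simp add: K_def)
  then have "finite S"
    by (simp add: S_def)
  have S: "k < n" "set (map ((+) k) \<alpha>) = {k + 1..<n}" "set \<beta> = {1..k}" "length \<beta> = k" "\<alpha> \<noteq> []"
    if "(k, \<alpha>, \<beta>) \<in> S" for k \<alpha> \<beta>
  proof -
    from that have *: "\<alpha> \<in> dumont132_of_size (n - 1 - k)" "\<beta> \<in> dumont132_of_size k" "even k" "k < n"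
      by (simp_all add: S_def K_def)
    show "k < n" by fact
    show "set (map ((+) k) \<alpha>) = {k + 1..<n}"
      using * by (auto simp: dumont132_of_size_iff image_add_atLeastAtMost)
    show "set \<beta> = {1..k}" "length \<beta> = k"
      using * by (auto simp: dumont132_of_size_iff length_dumont132_of_size)
    have "n - 1 - k \<noteq> 0"
      using assms * by presburger
    then show "\<alpha> \<noteq> []"
      using length_dumont132_of_size[OF *(1)] by auto
  qed
  have "inj_on h S"
  proof (rule inj_onI, clarsimp simp: h_def)
    fix k \<alpha> \<beta> k' \<alpha>' \<beta>'
    assume *: "(k, \<alpha>, \<beta>) \<in> S" "(k', \<alpha>', \<beta>') \<in> S"
      and eq: "map ((+) k) \<alpha> @ n # \<beta> = map ((+) k') \<alpha>' @ n # \<beta>'"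
    have "n \<notin> set (map ((+) k) \<alpha>)" "n \<notin> set \<beta>"
      using S(1-3)[OF *(1)] by auto
    \<comment> \<open>As \<open>n\<close> occurs only once, it marks the cut; \<open>k\<close> is
      then recovered as the length of \<open>\<beta>\<close>.\<close>
    then have **: "map ((+) k) \<alpha> = map ((+) k') \<alpha>'" "\<beta> = \<beta>'"
      using eq append_Cons_eq_iff by metis+
    then have "k = k'"
      using S(4)[OF *(1)] S(4)[OF *(2)] by simp
    with ** show "k = k' \<and> \<alpha> = \<alpha>' \<and> \<beta> = \<beta>'"
      by (simp add: inj_map_eq_map)
  qed
  \<comment> \<open>Words from \<open>S\<close> have a nonempty part before \<open>n\<close>, so
    they do not begin with \<open>n\<close>.\<close>
  have "(#) n ` dumont132_of_size (n - 1) \<inter> h ` S = {}"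
  proof -
    have "n # \<gamma> \<noteq> map ((+) k) \<alpha> @ n # \<beta>" if "(k, \<alpha>, \<beta>) \<in> S" for k \<alpha> \<beta> \<gamma>
      using S(2,5)[OF that] by (cases \<alpha>) auto
    then show ?thesis
      by (auto simp: h_def)
  qed
  then have "dumont132_sum x n = (\<Sum>\<pi>\<in>(#) n ` dumont132_of_size (n - 1). weight x \<pi>) +
      (\<Sum>\<pi>\<in>h ` S. weight x \<pi>)"
    unfolding dumont132_sum_def D using \<open>finite S\<close> by (intro sum.union_disjoint) auto
  also have "(\<Sum>\<pi>\<in>(#) n ` dumont132_of_size (n - 1). weight x \<pi>) = dumont132_sum x (n - 1)"
  proof -
    have "weight x (n # \<beta>) = weight x \<beta>" if "\<beta> \<in> dumont132_of_size (n - 1)" for \<beta>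
    proof -
      have "\<forall>b\<in>set \<beta>. b < n"
        using that assms(2) by (auto simp: dumont132_of_size_iff)
      then show ?thesis
        using weight_skew_sum[of "[n]" \<beta> x] by simp
    qed
    then show ?thesis
      by (subst sum.reindex) (auto simp: dumont132_sum_def)
  qed
  also have "(\<Sum>\<pi>\<in>h ` S. weight x \<pi>) = (\<Sum>s\<in>S. weight x (h s))"
    by (subst sum.reindex[OF \<open>inj_on h S\<close>]) simp
  also have "\<dots> = (\<Sum>(k, \<alpha>, \<beta>)\<in>S. x 2 * weight (\<lambda>j. x j * x (j + 1)) \<alpha> * weight x \<beta>)"
  proof (intro sum.cong refl, clarify)
    fix k \<alpha> \<beta> assume s: "(k, \<alpha>, \<beta>) \<in> S"
    have "weight x (h (k, \<alpha>, \<beta>)) = weight x ((map ((+) k) \<alpha> @ [n]) @ \<beta>)"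
      by (simp add: h_def)
    also have "\<dots> = weight x (map ((+) k) \<alpha> @ [n]) * weight x \<beta>"
      by (rule weight_skew_sum) (use S(1-3)[OF s] in auto)
    also have "weight x (map ((+) k) \<alpha> @ [n]) =
        x 2 * weight (\<lambda>j. x j * x (j + 1)) (map ((+) k) \<alpha>)"
      by (rule weight_snoc_max) (use S(2,5)[OF s] in auto)
    finally show "weight x (h (k, \<alpha>, \<beta>)) = x 2 * weight (\<lambda>j. x j * x (j + 1)) \<alpha> * weight x \<beta>"
      by (simp add: weight_map_add)
  qed
  also have "\<dots> = (\<Sum>k\<in>K. \<Sum>(\<alpha>, \<beta>)\<in>dumont132_of_size (n - 1 - k) \<times> dumont132_of_size k.
      x 2 * weight (\<lambda>j. x j * x (j + 1)) \<alpha> * weight x \<beta>)"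
    unfolding S_def using \<open>finite K\<close> by (subst sum.Sigma) (auto intro: sum.cong)
  also have "\<dots> = (\<Sum>k\<in>K. x 2 * dumont132_sum (\<lambda>j. x j * x (j + 1)) (n - 1 - k) *
      dumont132_sum x k)"
  proof (intro sum.cong refl)
    fix k
    have "(\<Sum>(\<alpha>, \<beta>)\<in>U \<times> V. c * f \<alpha> * g \<beta>) = c * sum f U * sum g V"
      for c :: 'a and f g :: "nat list \<Rightarrow> 'a" and U V
      by (simp add: sum.cartesian_product[symmetric] sum_distrib_left[of c] sum_product)
    then show "(\<Sum>(\<alpha>, \<beta>)\<in>dumont132_of_size (n - 1 - k) \<times> dumont132_of_size k.
        x 2 * weight (\<lambda>j. x j * x (j + 1)) \<alpha> * weight x \<beta>) =
      x 2 * dumont132_sum (\<lambda>j. x j * x (j + 1)) (n - 1 - k) * dumont132_sum x k"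
      by (simp add: dumont132_sum_def)
  qed
  finally show ?thesis
    unfolding K_def .
qed

section \<open>Functional equations for the even and odd parts\<close>

text \<open>Composition with \<open>- fps_X\<close> multiplies the coefficient at \<open>n\<close>
  by \<open>(-1) ^ n\<close>, and the factor 1/2 undoes the doubling of the even ones.\<close>

lemma A2_nth:
  assumes "(2 :: 'a::field) \<noteq> 0"
  shows "A2 (x :: nat \<Rightarrow> 'a) $ n = (if even n then dumont132_sum x n else 0)"
  using assms by (simp add: A2_def fps_compose_uminus' B_gf_nth field_simps)

lemma B2_nth:
  assumes "(2 :: 'a::field) \<noteq> 0"
  shows "B2 (x :: nat \<Rightarrow> 'a) $ n = (if odd n then dumont132_sum x n else 0)"
  using assms by (simp add: B2_def fps_compose_uminus' B_gf_nth field_simps)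

text \<open>The constant term 1 of \<open>A2\<close> turns \<open>1 - x 2 + x 2\<close> into 1,
  matching the exceptional coefficient at \<open>n = 1\<close>.\<close>

lemma B2_eq:
  fixes x :: "nat \<Rightarrow> 'a::field"
  assumes "(2 :: 'a) \<noteq> 0"
  shows "B2 x = fps_X * (1 - fps_const (x 2) + fps_const (x 2) * A2 (\<lambda>j. x j * x (j + 1)))"
proof (rule fps_ext)
  fix n
  show "B2 x $ n =
    (fps_X * (1 - fps_const (x 2) + fps_const (x 2) * A2 (\<lambda>j. x j * x (j + 1)))) $ n"
    using assms by (cases n) (auto simp: B2_nth A2_nth dumont132_sum_odd)
qed

text \<open>A leading maximum gives \<open>fps_X * B2 x\<close>. Otherwise the part before the
  maximum has odd size, and the part after it has positive even size, hence
  \<open>A2 x - 1\<close>.\<close>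

lemma A2_eq:
  fixes x :: "nat \<Rightarrow> 'a::field"
  assumes "(2 :: 'a) \<noteq> 0"
  shows "A2 x = 1 + fps_X * B2 x +
    fps_X * fps_const (x 2) * B2 (\<lambda>j. x j * x (j + 1)) * (A2 x - 1)"
proof (rule fps_ext)
  fix n
  let ?y = "\<lambda>j. x j * x (j + 1)"
  \<comment> \<open>The factors are swapped so that the convolution index is the size of the part
    after the maximum, as in \<open>dumont132_sum_even\<close>.\<close>
  have rhs: "(1 + fps_X * B2 x + fps_X * fps_const (x 2) * B2 ?y * (A2 x - 1)) $ n =
      (if n = 0 then 1 else B2 x $ (n - 1) + x 2 * ((A2 x - 1) * B2 ?y) $ (n - 1))"
    unfolding mult.commute[of "A2 x - 1"] by (simp add: mult.assoc)
  show "A2 x $ n = (1 + fps_X * B2 x + fps_X * fps_const (x 2) * B2 ?y * (A2 x - 1)) $ n"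
  proof (cases "n = 0")
    case True
    with assms show ?thesis
      unfolding rhs by (simp add: A2_nth)
  next
    case False
    have conv: "((A2 x - 1) * B2 ?y) $ (n - 1) =
        (\<Sum>k\<le>n - 1. (if even k \<and> k \<noteq> 0 \<and> odd (n - 1 - k)
           then dumont132_sum x k * dumont132_sum ?y (n - 1 - k) else 0))"
      unfolding fps_mult_nth atMost_atLeast0
      using assms by (intro sum.cong) (auto simp: A2_nth B2_nth)
    show ?thesis
    proof (cases "even n")
      case True
      have "((A2 x - 1) * B2 ?y) $ (n - 1) =
          (\<Sum>k | even k \<and> 0 < k \<and> k < n. dumont132_sum x k * dumont132_sum ?y (n - 1 - k))"
        unfolding conv
        using True False by (intro sum.mono_neutral_cong_right) auto
      then show ?thesis
        using assms True False dumont132_sum_even[OF True, of x]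
        unfolding rhs by (simp add: A2_nth B2_nth sum_distrib_left mult_ac)
    next
      case odd: False
      \<comment> \<open>For odd \<open>n\<close>, an even \<open>k\<close> makes
        \<open>n - 1 - k\<close> even, where the coefficient of \<open>B2\<close> vanishes.\<close>
      then have "((A2 x - 1) * B2 ?y) $ (n - 1) = 0"
        unfolding conv by (intro sum.neutral) auto
      then show ?thesis
        using assms odd False unfolding rhs by (simp add: A2_nth B2_nth)
    qed
  qed
qed

section \<open>The identities over the field of rational functions\<close>

lemma two_neq_0_ratfun: "(2 :: ratfun) \<noteq> 0"
proof -
  have "(2 :: ratfun) = Fract 2 1"
    using of_nat_fract[of 2, where 'a = "(nat \<Rightarrow>\<^sub>0 nat) \<Rightarrow>\<^sub>0 rat"] by simp
  also have "\<dots> \<noteq> 0"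
    by (simp add: Zero_fract_def eq_fract)
  finally show ?thesis .
qed

theorem theorem2p11:
  fixes x :: "nat \<Rightarrow> ratfun" and x1 x2 x3 :: "ratfun fps"
  defines "x \<equiv> indet"
    and "x1 \<equiv> fps_X"
    and "x2 \<equiv> fps_const (x 2)"
    and "x3 \<equiv> fps_const (x 3)"
  shows "A2 x = 1 + (x1^2 * (1 - x2 + x2 * A2 (\<lambda>j. x j * x (j + 1))))
                  / (1 - x1^2 * x2 * (1 - x2 * x3
                       + x2 * x3 * A2 (\<lambda>j. x j * x (j + 1)^2 * x (j + 2))))
       \<and> B2 x = x1 - x1 * x2 + x1 * x2 * A2 (\<lambda>j. x j * x (j + 1))"
proof
  let ?y = "\<lambda>j. x j * x (j + 1)"
  \<comment> \<open>\<open>C\<close> and \<open>E\<close> are the same expression, formed for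
    \<open>x\<close> and for \<open>?y\<close>.\<close>
  define C where "C = 1 - x2 + x2 * A2 ?y"
  define E where "E = 1 - x2 * x3 + x2 * x3 * A2 (\<lambda>j. x j * x (j + 1)^2 * x (j + 2))"
  have Bx: "B2 x = x1 * C"
    unfolding C_def x1_def x2_def by (rule B2_eq[OF two_neq_0_ratfun])
  \<comment> \<open>Iterating the substitution makes the middle factor appear twice, hence the
    square.\<close>
  have "(\<lambda>j. ?y j * ?y (j + 1)) = (\<lambda>j. x j * x (j + 1)^2 * x (j + 2))"
    by (simp add: power2_eq_square mult_ac)
  then have By: "B2 ?y = x1 * E"
    using B2_eq[OF two_neq_0_ratfun, of ?y]
    by (simp add: E_def x1_def x2_def x3_def numeral_3_eq_3 numeral_2_eq_2)
  have "A2 x = 1 + x1 * B2 x + x1 * x2 * B2 ?y * (A2 x - 1)"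
    unfolding x1_def x2_def by (rule A2_eq[OF two_neq_0_ratfun])
  \<comment> \<open>The equation is linear in \<open>A2 x - 1\<close>, whose multiples are collected
    on the left.\<close>
  then have "(A2 x - 1) * (1 - x1^2 * x2 * E) = x1^2 * C"
    unfolding Bx By by (simp add: algebra_simps power2_eq_square)
  \<comment> \<open>The denominator has constant term 1, so it is nonzero and can be
    cancelled.\<close>
  moreover have unit: "(1 - x1^2 * x2 * E) $ 0 \<noteq> 0"
    by (simp add: x1_def mult.assoc)
  then have "1 - x1^2 * x2 * E \<noteq> 0"
    using fps_zero_nth by metis
  ultimately have "A2 x - 1 = (x1^2 * C) / (1 - x1^2 * x2 * E)"
    by (metis nonzero_mult_div_cancel_right)
  then have "A2 x = 1 + (x1^2 * C) / (1 - x1^2 * x2 * E)"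
    by (simp add: algebra_simps)
  then show "A2 x = 1 + (x1^2 * (1 - x2 + x2 * A2 ?y)) / (1 - x1^2 * x2 * (1 - x2 * x3
                       + x2 * x3 * A2 (\<lambda>j. x j * x (j + 1)^2 * x (j + 2))))"
    unfolding C_def E_def .
  show "B2 x = x1 - x1 * x2 + x1 * x2 * A2 ?y"
    unfolding Bx C_def by (simp add: algebra_simps)
qed

end
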